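(* Let $M\ge 0$ and $N\ge 1$ be integers. There is a bijection between the set of pairs of partitions $(\alpha,\gamma)$, where each part of $\alpha$ does not exceed $M+N$ and $\gamma$ has at most $N$ parts, each not exceeding $M$, and the set of pairs of partitions $(\xi,\delta)$, where $\xi$ has at most $N$ parts and each part of $\delta$ does not exceed $M$, such that if $(\alpha,\gamma)$ corresponds to $(\xi,\delta)$ then $|\alpha|+|\gamma|=|\xi|+|\delta|$. Moreover, the subpartition of $\alpha$ consisting of all parts of $\alpha$ not exceeding $M$ coincides with $\delta$.
   Context: A partition is a finite non-increasing sequence of positive integers (its parts), possibly empty; $|\lambda|$ denotes the sum of the parts of $\lambda$. The subpartition of $\alpha$ consisting of all parts not exceeding $M$ keeps those parts with their multiplicities in $\alpha$. *)

theory Defs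
  imports Main
begin

definition is_partition :: "nat list \<Rightarrow> bool" where
  "is_partition p \<longleftrightarrow> sorted_wrt (\<ge>) p \<and> (\<forall>x\<in>set p. 0 < x)"

text \<open>The size \<open>|p|\<close> of a partition \<open>p\<close> is \<open>sum_list p\<close>, and its number of parts, counted
  with multiplicity, is \<open>length p\<close>.\<close>

definition parts_upto :: "nat \<Rightarrow> nat list \<Rightarrow> nat list" where
  "parts_upto M p = filter (\<lambda>x. x \<le> M) p"

definition alpha_gamma_pairs :: "nat \<Rightarrow> nat \<Rightarrow> (nat list \<times> nat list) set" where
  "alpha_gamma_pairs M N =
     {(\<alpha>, \<gamma>). is_partition \<alpha> \<and> (\<forall>x\<in>set \<alpha>. x \<le> M + N) \<and>
              is_partition \<gamma> \<and> length \<gamma> \<le> N \<and> (\<forall>x\<in>set \<gamma>. x \<le> M)}"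

definition xi_delta_pairs :: "nat \<Rightarrow> nat \<Rightarrow> (nat list \<times> nat list) set" where
  "xi_delta_pairs M N =
     {(\<xi>, \<delta>). is_partition \<xi> \<and> length \<xi> \<le> N \<and>
              is_partition \<delta> \<and> (\<forall>x\<in>set \<delta>. x \<le> M)}"

end

theory Submission
  imports Defs
begin

text \<open>
  The small parts of \<open>\<alpha>\<close> are forced to form \<open>\<delta>\<close>, so the content is a bijection
  \<open>(\<beta>, \<gamma>) \<mapsto> \<xi>\<close> with \<open>|\<beta>| + |\<gamma>| = |\<xi>|\<close>, where all parts of \<open>\<beta>\<close> lie in
  \<open>{M+1..M+N}\<close>. Write \<open>\<gamma>\<close> and \<open>\<xi>\<close> as non-increasing vectors of length \<open>N\<close>, padded by zeros.
  A part \<open>M+1+i\<close> is inserted into a vector by taking out the entry \<open>b\<close> at index \<open>i\<close>, adding 1 to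
  each of the \<open>i\<close> entries in front of it, and putting \<open>b+M+1\<close> at the front. The result is
  non-increasing exactly if the first entry of the vector exceeds \<open>b\<close> by at most \<open>M\<close>. Every
  insertion is possible on a vector with entries at most \<open>M\<close>, and after an insertion of \<open>p\<close> exactly
  the parts from \<open>M+1\<close> up to \<open>p\<close> can be inserted. Hence the parts of \<open>\<beta>\<close> can be inserted into
  \<open>\<gamma>\<close> in non-increasing order.

  The last insertion can be undone: the inserted part is read off from the number of entries that
  are within \<open>M\<close> of the first one (\<open>last_part_insert_part\<close>), and a removal is possible as soon as
  the first entry exceeds \<open>M\<close> (\<open>insert_removed_part\<close>). Successive removals produce parts in
  non-decreasing order (\<open>admissible_le_last_part\<close>), and they decrease the sum, so they end with a
  vector whose entries are at most \<open>M\<close>, which is \<open>\<gamma>\<close>.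
\<close>

section \<open>Inserting a part into a vector\<close>

text \<open>Non-increasing vectors of length \<open>N\<close>, with zero entries allowed.\<close>

definition noninc_vec :: "nat \<Rightarrow> nat list \<Rightarrow> bool" where
  "noninc_vec N v \<longleftrightarrow> length v = N \<and> sorted_wrt (\<ge>) v"

text \<open>The part \<open>p = M + 1 + i\<close> can be inserted into \<open>v\<close>, where the index \<open>i\<close> counts from zero.\<close>

definition admissible :: "nat \<Rightarrow> nat \<Rightarrow> nat list \<Rightarrow> bool" where
  "admissible M p v \<longleftrightarrow>
     M < p \<and> p - Suc M < length v \<and> hd v \<le> v ! (p - Suc M) + M"

text \<open>Insertion of the part \<open>p = M + 1 + i\<close>; it raises the sum by \<open>p\<close>.\<close>

definition insert_part :: "nat \<Rightarrow> nat \<Rightarrow> nat list \<Rightarrow> nat list" where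
  "insert_part M p v = (let i = p - Suc M in
     (v ! i + Suc M) # map Suc (take i v) @ drop (Suc i) v)"

text \<open>If \<open>v\<close> arises by an admissible insertion, this is the inserted part: the entries behind the
  first one that are within \<open>M\<close> of it are those that the insertion raised by 1.\<close>

definition last_part :: "nat \<Rightarrow> nat list \<Rightarrow> nat" where
  "last_part M v = Suc M + length (takeWhile (\<lambda>x. hd v \<le> x + M) (tl v))"

text \<open>In the same case, this is the vector into which that part was inserted.\<close>

definition remove_part :: "nat \<Rightarrow> nat list \<Rightarrow> nat list" where
  "remove_part M v =
     map (\<lambda>x. x - 1) (takeWhile (\<lambda>x. hd v \<le> x + M) (tl v)) @
     (hd v - Suc M) # dropWhile (\<lambda>x. hd v \<le> x + M) (tl v)"

lemma insert_part_split:
  assumes "p = Suc (M + length a)"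
  shows "insert_part M p (a @ b # c) = (b + Suc M) # map Suc a @ c"
  using assms by (simp add: insert_part_def)

lemma admissible_split:
  assumes "admissible M p v"
  obtains a b c where "v = a @ b # c" "p = Suc (M + length a)" "hd v \<le> b + M"
proof -
  let ?i = "p - Suc M"
  have i: "?i < length v" "M < p" "hd v \<le> v ! ?i + M"
    using assms by (auto simp: admissible_def)
  show thesis
  proof (rule that)
    show "v = take ?i v @ v ! ?i # drop (Suc ?i) v"
      using i(1) by (simp add: id_take_nth_drop)
    show "p = Suc (M + length (take ?i v))" using i by simp
    show "hd v \<le> v ! ?i + M" by (rule i(3))
  qed
qed

lemma sum_list_map_Suc: "sum_list (map Suc xs) = sum_list xs + length xs"
  by (induction xs) auto

lemma noninc_le_hd:
  assumes "sorted_wrt (\<ge>) v" "x \<in> set v"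
  shows "x \<le> hd (v :: nat list)"
  using assms by (cases v) auto

lemma
  assumes v: "noninc_vec N v" and p: "admissible M p v"
  shows noninc_vec_insert_part: "noninc_vec N (insert_part M p v)"
    and sum_list_insert_part: "sum_list (insert_part M p v) = sum_list v + p"
    and hd_insert_part: "M < hd (insert_part M p v)"
    and last_part_insert_part: "last_part M (insert_part M p v) = p"
    and remove_part_insert_part: "remove_part M (insert_part M p v) = v"
    and insert_part_admissible:
      "\<And>q. M < q \<Longrightarrow> q \<le> p \<Longrightarrow> admissible M q (insert_part M p v)"
proof -
  obtain a b c where s: "v = a @ b # c" "p = Suc (M + length a)" "hd v \<le> b + M"
    using p by (rule admissible_split)
  have ins: "insert_part M p v = (b + Suc M) # map Suc a @ c"
    using s(1,2) by (simp add: insert_part_split)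
  have srt: "sorted_wrt (\<ge>) (a @ b # c)" using v s(1) by (simp add: noninc_vec_def)
  then have ab: "\<forall>x\<in>set a. b \<le> x" and bc: "\<forall>x\<in>set c. x \<le> b"
    by (auto simp: sorted_wrt_append)
  have le: "\<forall>x\<in>set a. x \<le> b + M"
    using noninc_le_hd[OF srt] s(1,3) by fastforce
  have tw: "takeWhile (\<lambda>x. Suc b \<le> x) (map Suc a @ c) = map Suc a"
    and dw: "dropWhile (\<lambda>x. Suc b \<le> x) (map Suc a @ c) = c"
    using ab bc by (cases c; auto simp: takeWhile_append dropWhile_append)+
  have "\<forall>x\<in>set a. \<forall>y\<in>set c. y \<le> Suc x"
    using ab bc by (meson le_SucI le_trans)
  moreover have "\<forall>y\<in>set c. y \<le> b + Suc M" using bc by (meson trans_le_add1)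
  moreover have "sorted_wrt (\<ge>) a" "sorted_wrt (\<ge>) c" "length (a @ b # c) = N"
    using srt v s(1) by (auto simp: sorted_wrt_append noninc_vec_def)
  ultimately show "noninc_vec N (insert_part M p v)"
    using le unfolding noninc_vec_def ins
    by (auto simp: sorted_wrt_append sorted_wrt_map)
  show "sum_list (insert_part M p v) = sum_list v + p"
    unfolding ins by (simp add: s sum_list_map_Suc)
  show "M < hd (insert_part M p v)" unfolding ins by simp
  show "last_part M (insert_part M p v) = p"
    using tw s(2) unfolding ins last_part_def by simp
  show "remove_part M (insert_part M p v) = v"
    using tw dw s(1) unfolding ins remove_part_def by (simp add: comp_def)
  show "admissible M q (insert_part M p v)" if q: "M < q" "q \<le> p" for q
  proof (cases "q = Suc M")
    case True
    then show ?thesis unfolding ins by (simp add: admissible_def)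
  next
    case False
    define k where "k = q - Suc (Suc M)"
    have k: "q = Suc (Suc (M + k))" "k < length a"
      using False q s(2) unfolding k_def by auto
    then show ?thesis using ab unfolding ins by (auto simp: admissible_def nth_append)
  qed
qed

lemma
  assumes v: "noninc_vec N v" and N: "1 \<le> N" and hd: "M < hd v"
  shows noninc_vec_remove_part: "noninc_vec N (remove_part M v)"
    and admissible_last_part: "admissible M (last_part M v) (remove_part M v)"
    and insert_removed_part: "insert_part M (last_part M v) (remove_part M v) = v"
proof -
  obtain m xs where mx: "v = m # xs" using v N by (cases v) (auto simp: noninc_vec_def)
  define a where "a = takeWhile (\<lambda>x. m \<le> x + M) xs"
  define c where "c = dropWhile (\<lambda>x. m \<le> x + M) xs"
  have xs: "xs = a @ c" by (simp add: a_def c_def)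
  have rem: "remove_part M v = map (\<lambda>x. x - 1) a @ (m - Suc M) # c"
    and last: "last_part M v = Suc (M + length a)"
    by (simp_all add: remove_part_def last_part_def mx a_def c_def)
  have m: "M < m" using hd mx by simp
  have srt: "sorted_wrt (\<ge>) a" "sorted_wrt (\<ge>) c" and ac: "\<forall>x\<in>set a. \<forall>y\<in>set c. y \<le> x"
    and am: "\<forall>x\<in>set a. x \<le> m"
    using v by (auto simp: noninc_vec_def mx xs sorted_wrt_append)
  have a: "\<forall>x\<in>set a. m \<le> x + M" unfolding a_def using set_takeWhileD by fastforce
  have c: "\<forall>x\<in>set c. x + M < m"
  proof (cases c)
    case (Cons y ys)
    then have "\<not> m \<le> y + M" unfolding c_def by (metis dropWhile_eq_Cons_conv)
    then show ?thesis using srt(2) Cons by auto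
  qed simp
  show "noninc_vec N (remove_part M v)"
    unfolding noninc_vec_def rem
  proof
    show "length (map (\<lambda>x. x - 1) a @ (m - Suc M) # c) = N"
      using v by (simp add: noninc_vec_def mx xs)
    have "sorted_wrt (\<ge>) (map (\<lambda>x. x - 1) a)"
      unfolding sorted_wrt_map by (rule sorted_wrt_mono_rel[OF _ srt(1)]) auto
    then show "sorted_wrt (\<ge>) (map (\<lambda>x. x - 1) a @ (m - Suc M) # c)"
      using srt(2) a c m by (fastforce simp: sorted_wrt_append)
  qed
  have "hd (remove_part M v) \<le> m - Suc M + M"
    unfolding rem using am m by (cases a) auto
  then show "admissible M (last_part M v) (remove_part M v)"
    unfolding last by (simp add: admissible_def rem nth_append)
  have "map Suc (map (\<lambda>x. x - 1) a) = a"
    using a m by (fastforce intro!: map_idI)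
  then show "insert_part M (last_part M v) (remove_part M v) = v"
    unfolding rem last using m by (subst insert_part_split) (simp_all add: mx xs)
qed

text \<open>No part can be inserted directly after a smaller one; this makes the successively removed parts
  non-decreasing.\<close>

lemma admissible_le_last_part:
  assumes v: "noninc_vec N v" and p: "admissible M p v"
  shows "p \<le> last_part M v"
proof -
  obtain a b c where s: "v = a @ b # c" "p = Suc (M + length a)" "hd v \<le> b + M"
    using p by (rule admissible_split)
  show ?thesis
  proof (cases a)
    case Nil
    then show ?thesis using s(2) by (simp add: last_part_def)
  next
    case (Cons m xs)
    have "\<forall>x\<in>set (xs @ [b]). hd v \<le> x + M"
      using v s(3) unfolding noninc_vec_def s(1) Cons by (fastforce simp: sorted_wrt_append)
    then have "takeWhile (\<lambda>x. hd v \<le> x + M) ((xs @ [b]) @ c) =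
        (xs @ [b]) @ takeWhile (\<lambda>x. hd v \<le> x + M) c"
      by (intro takeWhile_append2) auto
    then show ?thesis using s(2) by (simp add: last_part_def s(1) Cons)
  qed
qed

section \<open>Inserting a partition\<close>

text \<open>The partitions with all parts in \<open>{M+1..M+N}\<close>.\<close>

definition big_partition :: "nat \<Rightarrow> nat \<Rightarrow> nat list \<Rightarrow> bool" where
  "big_partition M N \<beta> \<longleftrightarrow> sorted_wrt (\<ge>) \<beta> \<and> (\<forall>x\<in>set \<beta>. M < x \<and> x \<le> M + N)"

text \<open>The non-increasing vectors of length \<open>N\<close> with entries at most \<open>M\<close>.\<close>

definition box_vec :: "nat \<Rightarrow> nat \<Rightarrow> nat list \<Rightarrow> bool" where
  "box_vec M N g \<longleftrightarrow> noninc_vec N g \<and> (\<forall>x\<in>set g. x \<le> M)"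

lemma big_partition_snoc:
  "big_partition M N (\<beta> @ [p]) \<longleftrightarrow>
     big_partition M N \<beta> \<and> M < p \<and> p \<le> M + N \<and> (\<forall>x\<in>set \<beta>. p \<le> x)"
  by (auto simp: big_partition_def sorted_wrt_append)

lemma admissible_box_vec:
  assumes "box_vec M N g" "M < p" "p \<le> M + N"
  shows "admissible M p g"
proof -
  have "p - Suc M < length g" using assms by (auto simp: box_vec_def noninc_vec_def)
  moreover from this have "hd g \<le> M" using assms(1) by (cases g) (auto simp: box_vec_def)
  ultimately show ?thesis using assms(2) by (simp add: admissible_def)
qed

lemma fold_insert_part:
  assumes "box_vec M N g" "big_partition M N \<beta>"
  shows "noninc_vec N (fold (insert_part M) \<beta> g) \<and>
    sum_list (fold (insert_part M) \<beta> g) = sum_list \<beta> + sum_list g \<and>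
    (\<forall>p. M < p \<longrightarrow> p \<le> M + N \<longrightarrow> (\<forall>x\<in>set \<beta>. p \<le> x) \<longrightarrow>
       admissible M p (fold (insert_part M) \<beta> g))"
  using assms(2)
proof (induction \<beta> rule: rev_induct)
  case Nil
  then show ?case using assms(1) by (simp add: admissible_box_vec) (simp add: box_vec_def)
next
  case (snoc p \<beta>)
  then have "noninc_vec N (fold (insert_part M) \<beta> g)" "admissible M p (fold (insert_part M) \<beta> g)"
    by (auto simp: big_partition_snoc)
  from noninc_vec_insert_part[OF this] sum_list_insert_part[OF this] insert_part_admissible[OF this]
  show ?case using snoc by (simp add: big_partition_snoc)
qed

lemmas noninc_vec_fold = fold_insert_part[THEN conjunct1]
  and sum_list_fold = fold_insert_part[THEN conjunct2, THEN conjunct1]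

lemma admissible_fold:
  assumes "box_vec M N g" "big_partition M N (\<beta> @ [p])"
  shows "admissible M p (fold (insert_part M) \<beta> g)"
  using assms fold_insert_part[of M N g \<beta>] by (simp add: big_partition_snoc)

lemma
  assumes "box_vec M N g" "big_partition M N (\<beta> @ [p])"
  shows hd_fold_snoc: "M < hd (fold (insert_part M) (\<beta> @ [p]) g)"
    and last_part_fold_snoc: "last_part M (fold (insert_part M) (\<beta> @ [p]) g) = p"
    and remove_part_fold_snoc:
      "remove_part M (fold (insert_part M) (\<beta> @ [p]) g) = fold (insert_part M) \<beta> g"
proof -
  have "noninc_vec N (fold (insert_part M) \<beta> g)"
    using assms by (auto simp: big_partition_snoc intro: noninc_vec_fold)
  note * = this admissible_fold[OF assms]
  show "M < hd (fold (insert_part M) (\<beta> @ [p]) g)"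
    using hd_insert_part[OF *] by simp
  show "last_part M (fold (insert_part M) (\<beta> @ [p]) g) = p"
    using last_part_insert_part[OF *] by simp
  show "remove_part M (fold (insert_part M) (\<beta> @ [p]) g) = fold (insert_part M) \<beta> g"
    using remove_part_insert_part[OF *] by simp
qed

lemma fold_insert_part_eq_box_vec:
  assumes N: "1 \<le> N" and g: "box_vec M N g" and \<beta>: "big_partition M N \<beta>"
    and box: "box_vec M N (fold (insert_part M) \<beta> g)"
  shows "\<beta> = []"
proof (cases \<beta> rule: rev_cases)
  case (snoc \<beta>' p)
  have "hd (fold (insert_part M) \<beta> g) \<le> M"
    using box N by (cases "fold (insert_part M) \<beta> g") (auto simp: box_vec_def noninc_vec_def)
  then show ?thesis using hd_fold_snoc[of M N g \<beta>' p] g \<beta> snoc by simp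
qed simp

lemma fold_insert_part_inj:
  assumes N: "1 \<le> N" and g: "box_vec M N g" "box_vec M N g'"
    and "big_partition M N \<beta>" "big_partition M N \<beta>'"
    and "fold (insert_part M) \<beta> g = fold (insert_part M) \<beta>' g'"
  shows "\<beta> = \<beta>' \<and> g = g'"
  using assms(4-)
proof (induction \<beta> arbitrary: \<beta>' rule: rev_induct)
  case Nil
  then have "\<beta>' = []" using fold_insert_part_eq_box_vec[OF N g(2)] g(1) by simp
  then show ?case using Nil by simp
next
  case (snoc p \<beta>)
  show ?case
  proof (cases \<beta>' rule: rev_cases)
    case Nil
    then have "\<beta> @ [p] = []"
      using snoc.prems g(2) by (intro fold_insert_part_eq_box_vec[OF N g(1)]) simp_all
    then show ?thesis by simp
  next
    case (snoc \<beta>'' p')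
    note big = snoc.prems(1) snoc.prems(2)[unfolded snoc]
      and eq = snoc.prems(3)[unfolded snoc]
    have "p = p'"
      using last_part_fold_snoc[OF g(1) big(1)] last_part_fold_snoc[OF g(2) big(2)] eq by simp
    moreover have "fold (insert_part M) \<beta> g = fold (insert_part M) \<beta>'' g'"
      using remove_part_fold_snoc[OF g(1) big(1)] remove_part_fold_snoc[OF g(2) big(2)] eq by simp
    then have "\<beta> = \<beta>'' \<and> g = g'"
      using big by (intro snoc.IH) (simp_all add: big_partition_snoc)
    ultimately show ?thesis using snoc by simp
  qed
qed

lemma fold_insert_part_surj:
  assumes N: "1 \<le> N" and v: "noninc_vec N v"
  shows "\<exists>\<beta> g. big_partition M N \<beta> \<and> box_vec M N g \<and> fold (insert_part M) \<beta> g = v"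
  using v
proof (induction "sum_list v" arbitrary: v rule: less_induct)
  case less
  show ?case
  proof (cases "M < hd v")
    case False
    then have "box_vec M N v"
      using less.prems noninc_le_hd unfolding box_vec_def noninc_vec_def by fastforce
    moreover have "big_partition M N []" by (simp add: big_partition_def)
    ultimately show ?thesis by (intro exI[of _ "[]"] exI[of _ v]) simp
  next
    case True
    let ?p = "last_part M v" and ?u = "remove_part M v"
    note u = noninc_vec_remove_part[OF less.prems N True]
      and adm = admissible_last_part[OF less.prems N True]
      and ins = insert_removed_part[OF less.prems N True]
    have p: "M < ?p" "?p \<le> M + N" using adm u by (auto simp: admissible_def noninc_vec_def)
    have "sum_list ?u < sum_list v" using sum_list_insert_part[OF u adm] ins p by simp
    from less.hyps[OF this u] obtain \<beta> g
      where \<beta>: "big_partition M N \<beta>" and g: "box_vec M N g"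
        and fold: "fold (insert_part M) \<beta> g = ?u" by blast
    have "\<forall>x\<in>set \<beta>. ?p \<le> x"
    proof (cases \<beta> rule: rev_cases)
      case (snoc \<beta>' q)
      \<comment> \<open>\<open>q\<close>, the smallest part of \<open>\<beta>\<close>, is the last one inserted.\<close>
      have "last_part M ?u = q"
        using last_part_fold_snoc[of M N g \<beta>' q] g \<beta> fold snoc by simp
      then have "?p \<le> q" using admissible_le_last_part[OF u adm] by simp
      moreover have "\<forall>x\<in>set \<beta>. q \<le> x" using \<beta> snoc by (auto simp: big_partition_snoc)
      ultimately show ?thesis by fastforce
    qed simp
    then have "big_partition M N (\<beta> @ [?p])" using \<beta> p by (simp add: big_partition_snoc)
    moreover have "fold (insert_part M) (\<beta> @ [?p]) g = v" using fold ins by simp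
    ultimately show ?thesis using g by blast
  qed
qed

section \<open>Partitions as vectors padded by zeros\<close>

text \<open>A partition with at most \<open>N\<close> parts becomes a vector of length \<open>N\<close>.\<close>

definition pad :: "nat \<Rightarrow> nat list \<Rightarrow> nat list" where
  "pad N p = p @ replicate (N - length p) 0"

abbreviation positive_entries :: "nat list \<Rightarrow> nat list" where
  "positive_entries v \<equiv> filter (\<lambda>x. 0 < x) v"

lemma noninc_vec_pad:
  assumes "is_partition p" "length p \<le> N"
  shows "noninc_vec N (pad N p)"
proof -
  have "sorted_wrt (\<ge>) (replicate n (0 :: nat))" for n
    by (induction n) auto
  then show ?thesis
    using assms by (auto simp: noninc_vec_def pad_def is_partition_def sorted_wrt_append)
qed

lemma positive_entries_pad:
  assumes "is_partition p"
  shows "positive_entries (pad N p) = p"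
  using assms by (auto simp: pad_def is_partition_def)

lemma sum_list_pad: "sum_list (pad N p) = sum_list p"
  by (simp add: pad_def sum_list_replicate)

lemma is_partition_positive_entries:
  assumes "noninc_vec N v"
  shows "is_partition (positive_entries v)" "length (positive_entries v) \<le> N"
  using assms by (auto simp: noninc_vec_def is_partition_def intro: sorted_wrt_filter)

lemma sum_list_positive_entries: "sum_list (positive_entries v) = sum_list (v :: nat list)"
  by (induction v) auto

lemma pad_positive_entries:
  assumes "noninc_vec N v"
  shows "pad N (positive_entries v) = v"
proof -
  have "sorted_wrt (\<ge>) v \<Longrightarrow> pad (length v) (positive_entries v) = v"
  proof (induction v)
    case (Cons x v)
    show ?case
    proof (cases "x = 0")
      case True
      then have "\<forall>y\<in>set (x # v). y = 0" using Cons.prems by auto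
      then have "x # v = replicate (length (x # v)) 0"
        by (metis replicate_length_same)
      moreover have "positive_entries (x # v) = []"
        using \<open>\<forall>y\<in>set (x # v). y = 0\<close> by (simp add: filter_empty_conv)
      ultimately show ?thesis by (simp only: pad_def) simp
    next
      case False
      then show ?thesis using Cons by (simp add: pad_def)
    qed
  qed (simp add: pad_def)
  then show ?thesis using assms by (auto simp: noninc_vec_def)
qed

lemma box_vec_pad:
  assumes "is_partition p" "length p \<le> N" "\<forall>x\<in>set p. x \<le> M"
  shows "box_vec M N (pad N p)"
  using assms noninc_vec_pad by (auto simp: box_vec_def pad_def)

lemma noninc_split_at:
  assumes "sorted_wrt (\<ge>) (p :: nat list)"
  shows "filter (\<lambda>x. M < x) p @ filter (\<lambda>x. x \<le> M) p = p"
  using assms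
proof (induction p)
  case (Cons x p)
  show ?case
  proof (cases "M < x")
    case False
    then have "filter (\<lambda>x. M < x) p = []" using Cons.prems by (auto simp: filter_empty_conv)
    then show ?thesis using Cons False by simp
  qed (use Cons in simp)
qed simp

section \<open>The bijection\<close>

text \<open>The parts of \<open>\<alpha>\<close> above \<open>M\<close> are inserted into \<open>\<gamma>\<close>, largest first; the others are kept.\<close>

definition insertion_map :: "nat \<Rightarrow> nat \<Rightarrow> nat list \<times> nat list \<Rightarrow> nat list \<times> nat list" where
  "insertion_map M N = (\<lambda>(\<alpha>, \<gamma>).
     (positive_entries (fold (insert_part M) (filter (\<lambda>x. M < x) \<alpha>) (pad N \<gamma>)),
      parts_upto M \<alpha>))"

lemma alpha_gamma_pairsD:
  assumes "(\<alpha>, \<gamma>) \<in> alpha_gamma_pairs M N"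
  shows "big_partition M N (filter (\<lambda>x. M < x) \<alpha>)" "box_vec M N (pad N \<gamma>)"
    and "filter (\<lambda>x. M < x) \<alpha> @ parts_upto M \<alpha> = \<alpha>"
proof -
  have \<alpha>: "sorted_wrt (\<ge>) \<alpha>" "\<forall>x\<in>set \<alpha>. x \<le> M + N"
    using assms by (auto simp: alpha_gamma_pairs_def is_partition_def)
  show "big_partition M N (filter (\<lambda>x. M < x) \<alpha>)"
    using \<alpha> by (auto simp: big_partition_def intro: sorted_wrt_filter)
  show "box_vec M N (pad N \<gamma>)"
    using assms by (simp add: alpha_gamma_pairs_def box_vec_pad)
  show "filter (\<lambda>x. M < x) \<alpha> @ parts_upto M \<alpha> = \<alpha>"
    unfolding parts_upto_def by (rule noninc_split_at[OF \<alpha>(1)])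
qed

lemma insertion_map_sum:
  assumes "(\<alpha>, \<gamma>) \<in> alpha_gamma_pairs M N" "insertion_map M N (\<alpha>, \<gamma>) = (\<xi>, \<delta>)"
  shows "sum_list \<alpha> + sum_list \<gamma> = sum_list \<xi> + sum_list \<delta>"
proof -
  note D = alpha_gamma_pairsD[OF assms(1)]
  have "sum_list \<xi> = sum_list (filter (\<lambda>x. M < x) \<alpha>) + sum_list \<gamma>"
    using assms(2) sum_list_fold[OF D(2,1)]
    by (auto simp: insertion_map_def sum_list_positive_entries sum_list_pad)
  moreover have "sum_list \<alpha> = sum_list (filter (\<lambda>x. M < x) \<alpha>) + sum_list \<delta>"
    using arg_cong[OF D(3), of sum_list] assms(2) by (simp add: insertion_map_def)
  ultimately show ?thesis by simp
qed

lemma inj_on_insertion_map: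
  assumes "1 \<le> N"
  shows "inj_on (insertion_map M N) (alpha_gamma_pairs M N)"
proof (rule inj_onI, clarify)
  fix \<alpha> \<gamma> \<alpha>' \<gamma>'
  assume A: "(\<alpha>, \<gamma>) \<in> alpha_gamma_pairs M N" and A': "(\<alpha>', \<gamma>') \<in> alpha_gamma_pairs M N"
    and eq: "insertion_map M N (\<alpha>, \<gamma>) = insertion_map M N (\<alpha>', \<gamma>')"
  note D = alpha_gamma_pairsD[OF A] and D' = alpha_gamma_pairsD[OF A']
  let ?big = "filter (\<lambda>x. M < x)"
  have "fold (insert_part M) (?big \<alpha>) (pad N \<gamma>) = fold (insert_part M) (?big \<alpha>') (pad N \<gamma>')"
    (is "?v = ?v'")
  proof -
    have "pad N (positive_entries ?v) = pad N (positive_entries ?v')"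
      using eq by (simp add: insertion_map_def)
    then show ?thesis
      by (simp only: pad_positive_entries[OF noninc_vec_fold[OF D(2,1)]]
          pad_positive_entries[OF noninc_vec_fold[OF D'(2,1)]])
  qed
  then have eqs: "?big \<alpha> = ?big \<alpha>'" "pad N \<gamma> = pad N \<gamma>'"
    using fold_insert_part_inj[OF assms D(2) D'(2) D(1) D'(1)] by blast+
  have "is_partition \<gamma>" "is_partition \<gamma>'" using A A' by (simp_all add: alpha_gamma_pairs_def)
  with arg_cong[OF eqs(2), of positive_entries] have "\<gamma> = \<gamma>'"
    by (simp only: positive_entries_pad)
  moreover have "parts_upto M \<alpha> = parts_upto M \<alpha>'" using eq by (simp add: insertion_map_def)
  with eqs(1) have "?big \<alpha> @ parts_upto M \<alpha> = ?big \<alpha>' @ parts_upto M \<alpha>'" by (simp only:)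
  then have "\<alpha> = \<alpha>'" by (simp only: D(3) D'(3))
  ultimately show "\<alpha> = \<alpha>' \<and> \<gamma> = \<gamma>'" by simp
qed

lemma image_insertion_map:
  assumes "1 \<le> N"
  shows "insertion_map M N ` alpha_gamma_pairs M N = xi_delta_pairs M N"
proof (intro equalityI subsetI)
  fix y assume "y \<in> insertion_map M N ` alpha_gamma_pairs M N"
  then obtain \<alpha> \<gamma> where A: "(\<alpha>, \<gamma>) \<in> alpha_gamma_pairs M N" and y: "y = insertion_map M N (\<alpha>, \<gamma>)"
    by auto
  have "is_partition (parts_upto M \<alpha>)"
    using A by (auto simp: alpha_gamma_pairs_def parts_upto_def is_partition_def
        intro: sorted_wrt_filter)
  then show "y \<in> xi_delta_pairs M N"
    using is_partition_positive_entries[OF noninc_vec_fold[OF alpha_gamma_pairsD(2,1)[OF A]]]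
    by (simp add: y insertion_map_def xi_delta_pairs_def) (simp add: parts_upto_def)
next
  fix y assume "y \<in> xi_delta_pairs M N"
  then obtain \<xi> \<delta> where y: "y = (\<xi>, \<delta>)" and \<xi>: "is_partition \<xi>" "length \<xi> \<le> N"
    and \<delta>: "is_partition \<delta>" "\<forall>x\<in>set \<delta>. x \<le> M"
    by (auto simp: xi_delta_pairs_def)
  obtain \<beta> g where \<beta>: "big_partition M N \<beta>" and g: "box_vec M N g"
    and fold: "fold (insert_part M) \<beta> g = pad N \<xi>"
    using fold_insert_part_surj[OF assms noninc_vec_pad[OF \<xi>]] by blast
  have nv: "noninc_vec N g" using g by (simp add: box_vec_def)
  have "is_partition (\<beta> @ \<delta>)"
    using \<beta> \<delta> by (fastforce simp: is_partition_def big_partition_def sorted_wrt_append)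
  moreover have "\<forall>x\<in>set (\<beta> @ \<delta>). x \<le> M + N"
    using \<beta> \<delta> by (auto simp: big_partition_def)
  ultimately have "(\<beta> @ \<delta>, positive_entries g) \<in> alpha_gamma_pairs M N"
    using is_partition_positive_entries[OF nv] g
    by (simp add: alpha_gamma_pairs_def box_vec_def)
  moreover have "filter (\<lambda>x. M < x) (\<beta> @ \<delta>) = \<beta>" "parts_upto M (\<beta> @ \<delta>) = \<delta>"
    using \<beta> \<delta> by (auto simp: parts_upto_def big_partition_def filter_empty_conv filter_id_conv not_less)
  then have "insertion_map M N (\<beta> @ \<delta>, positive_entries g) = y"
    by (simp add: insertion_map_def y pad_positive_entries[OF nv] fold positive_entries_pad[OF \<xi>(1)]
        del: filter_append)
  ultimately show "y \<in> insertion_map M N ` alpha_gamma_pairs M N" by blast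
qed

theorem corollary1p3:
  fixes M N :: nat
  assumes "N \<ge> 1"
  shows "\<exists>f. bij_betw f (alpha_gamma_pairs M N) (xi_delta_pairs M N) \<and>
    (\<forall>\<alpha> \<gamma> \<xi> \<delta>. (\<alpha>, \<gamma>) \<in> alpha_gamma_pairs M N \<longrightarrow> f (\<alpha>, \<gamma>) = (\<xi>, \<delta>) \<longrightarrow>
       sum_list \<alpha> + sum_list \<gamma> = sum_list \<xi> + sum_list \<delta> \<and>
       parts_upto M \<alpha> = \<delta>)"
proof (intro exI[of _ "insertion_map M N"] conjI allI impI)
  show "bij_betw (insertion_map M N) (alpha_gamma_pairs M N) (xi_delta_pairs M N)"
    using inj_on_insertion_map[OF assms] image_insertion_map[OF assms] by (simp add: bij_betw_def)
qed (auto dest: insertion_map_sum simp: insertion_map_def)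

end
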